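(* Let $m>n>0$ be coprime integers with $m-n$ odd, and let $H_{m,n}$, $E_{m,n}$, $\tau$, $O$, $\mathcal{T}_\tau$ be as defined in the context. A point $P\in E_{m,n}(\mathbb{Q})\setminus(\{O\}\cup\mathcal{T}_\tau)$ lifts to a rational solution $t\in\mathbb{Q}^\times$ of the quartic $H_{m,n}$ if and only if $\tau(P)$ is a positive rational square (i.e. $\tau(P)>0$ and $\tau(P)=r^2$ for some $r\in\mathbb{Q}$); the lift is unique up to the sign ambiguity $t\mapsto -t$. Moreover, for such a $t=a/b$ written in lowest terms with $b>0$, write $|a/b|=a'/b'$ with $a',b'>0$ coprime. Then $(a',b',m,n)$ is a Master-Hit if and only if $a'>b'$ and $a'-b'$ is odd.
   Context: **Master-Hits.** For positive integers $a,b,m,n$ put $U_1=a^2-b^2$, $V_1=2ab$, $W_1=a^2+b^2$, $U_2=m^2-n^2$, $V_2=2mn$, $W_2=m^2+n^2$, and $M(a,b,m,n)=(V_1U_2)^2+(U_1V_2)^2$. A tuple $(a,b,m,n)$ of positive integers is a *Master-Hit* if $a>b>0$, $m>n>0$, $\gcd(a,b)=\gcd(m,n)=1$, $a-b$ and $m-n$ are odd, and $M(a,b,m,n)$ is a perfect square in $\mathbb{Z}$. **The curves.** For fixed coprime $m>n>0$ with $m-n$ odd, put $U_2=m^2-n^2$, $\gamma=V_2=2mn$, $B=4U_2^2-2V_2^2$. Let $H_{m,n}$ be the genus-one quartic $$s^2=V_2^2t^4+(4U_2^2-2V_2^2)t^2+V_2^2 ,$$ which has the rational point $(t,s)=(0,\gamma)$.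 Let $E_{m,n}: Y^2=X^3+a_2X^2+a_4X+a_6$ (with $a_2,a_4,a_6\in\mathbb{Q}$) be the Weierstrass model of $H_{m,n}$ given by a birational map $\phi_{m,n}:H_{m,n}\dashrightarrow E_{m,n}$ over $\mathbb{Q}$ which sends $(0,\gamma)$ to the point at infinity $O$ and whose $X$-coordinate is $$X(t,s)=\frac{2\gamma(s+\gamma)}{t^2}.$$ Let $\tau$ be the rational function on $E_{m,n}$ $$\tau=\tau(X)=\frac{4\gamma^2(X+B)}{X^2-4\gamma^4},$$ and let $\mathcal{T}_\tau\subset E_{m,n}[2]$ be the set of the two $2$-torsion points with $X=\pm2\gamma^2$, where $\tau$ is undefined. **Lifting.** Only the $X$-coordinate of $\phi_{m,n}$ is used: a point $P\in E_{m,n}(\mathbb{Q})$ *lifts to* $t\in\mathbb{Q}^\times$ if there is $s\in\mathbb{Q}$ with $(t,s)\in H_{m,n}(\mathbb{Q})$ and $X(t,s)=X(P)$. *)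

theory Defs
  imports "HOL-Analysis.Analysis" "HOL-Computational_Algebra.Polynomial"
begin

subsection \<open>Master-Hits\<close>

definition leg_U :: "int \<Rightarrow> int \<Rightarrow> int" where
  "leg_U m n = m\<^sup>2 - n\<^sup>2"

definition leg_V :: "int \<Rightarrow> int \<Rightarrow> int" where
  "leg_V m n = 2 * m * n"

definition master_M :: "int \<Rightarrow> int \<Rightarrow> int \<Rightarrow> int \<Rightarrow> int" where
  "master_M a b m n = (leg_V a b * leg_U m n)\<^sup>2 + (leg_U a b * leg_V m n)\<^sup>2"

definition master_hit :: "int \<Rightarrow> int \<Rightarrow> int \<Rightarrow> int \<Rightarrow> bool" where
  "master_hit a b m n \<longleftrightarrow>
     a > b \<and> b > 0 \<and> m > n \<and> n > 0 \<and> coprime a b \<and> coprime m n \<and>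
     odd (a - b) \<and> odd (m - n) \<and> (\<exists>k. master_M a b m n = k\<^sup>2)"


subsection \<open>Affine curves\<close>

text \<open>Curves are given by their affine equations and are polymorphic in the field, so that the
  same equation can be read over the rationals (for rational points) and over the complex numbers
  (for rational maps).\<close>

definition coeff_B :: "int \<Rightarrow> int \<Rightarrow> int" where
  "coeff_B m n = 4 * (leg_U m n)\<^sup>2 - 2 * (leg_V m n)\<^sup>2"

definition quartic_H :: "int \<Rightarrow> int \<Rightarrow> ('a::field_char_0 \<times> 'a) set" where
  "quartic_H m n = {(t, s). s\<^sup>2 = (of_int (leg_V m n))\<^sup>2 * t ^ 4
                          + of_int (coeff_B m n) * t\<^sup>2
                          + (of_int (leg_V m n))\<^sup>2}"

definition weierstrass :: "'a::field_char_0 \<Rightarrow> 'a \<Rightarrow> 'a \<Rightarrow> ('a \<times> 'a) set" where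
  "weierstrass a2 a4 a6 = {(x, y). y\<^sup>2 = x ^ 3 + a2 * x\<^sup>2 + a4 * x + a6}"

text \<open>The function \<open>X(t, s)\<close>; only meaningful for \<open>t \<noteq> 0\<close>.\<close>

definition X_fun :: "int \<Rightarrow> int \<Rightarrow> 'a::field_char_0 \<Rightarrow> 'a \<Rightarrow> 'a" where
  "X_fun m n t s = 2 * of_int (leg_V m n) * (s + of_int (leg_V m n)) / t\<^sup>2"


subsection \<open>Birational maps over the rationals\<close>

text \<open>A polynomial in two variables over the rationals is an element of \<open>rat poly poly\<close>; the inner
  variable is the first coordinate, the outer variable the second coordinate.\<close>

definition eval2 :: "rat poly poly \<Rightarrow> complex \<times> complex \<Rightarrow> complex" where
  "eval2 F p = poly (map_poly (\<lambda>c. poly (map_poly of_rat c) (fst p)) F) (snd p)"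

text \<open>All curves below are irreducible over the complex numbers, so the nonempty Zariski-open
  subsets of their complex points are exactly the cofinite ones.\<close>

definition generically :: "'a set \<Rightarrow> ('a \<Rightarrow> bool) \<Rightarrow> bool" where
  "generically C Q \<longleftrightarrow> finite {p \<in> C. \<not> Q p}"

definition rational_function_on ::
    "(complex \<times> complex) set \<Rightarrow> (complex \<times> complex \<Rightarrow> complex) \<Rightarrow> bool" where
  "rational_function_on C f \<longleftrightarrow>
     (\<exists>F G. generically C (\<lambda>p. eval2 G p \<noteq> 0 \<and> f p = eval2 F p / eval2 G p))"

definition rational_map_on ::
    "(complex \<times> complex) set \<Rightarrow> (complex \<times> complex) set \<Rightarrow>
     (complex \<times> complex \<Rightarrow> complex \<times> complex) \<Rightarrow> bool" where
  "rational_map_on C D f \<longleftrightarrow>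
     rational_function_on C (\<lambda>p. fst (f p)) \<and> rational_function_on C (\<lambda>p. snd (f p)) \<and>
     generically C (\<lambda>p. f p \<in> D)"

definition birational_map_on ::
    "(complex \<times> complex) set \<Rightarrow> (complex \<times> complex) set \<Rightarrow>
     (complex \<times> complex \<Rightarrow> complex \<times> complex) \<Rightarrow> bool" where
  "birational_map_on C D f \<longleftrightarrow>
     rational_map_on C D f \<and>
     (\<exists>g. rational_map_on D C g \<and>
          generically C (\<lambda>p. g (f p) = p) \<and> generically D (\<lambda>q. f (g q) = q))"

text \<open>\<open>Y\<^sup>2 = X\<^sup>3 + a2 X\<^sup>2 + a4 X + a6\<close> is the model \<open>E\<^bsub>m,n\<^esub>\<close>. The only point of the projective
  closure of this curve outside the affine plane is \<open>O\<close>, so \<open>\<phi>\<close> sends the (smooth) point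
  \<open>(0, \<gamma>)\<close> to \<open>O\<close> iff \<open>\<phi>\<close> tends to infinity there. Here \<open>\<gamma> = leg_V m n\<close>.\<close>

definition weierstrass_model :: "int \<Rightarrow> int \<Rightarrow> rat \<Rightarrow> rat \<Rightarrow> rat \<Rightarrow> bool" where
  "weierstrass_model m n a2 a4 a6 \<longleftrightarrow>
     (\<exists>\<phi>. birational_map_on (quartic_H m n) (weierstrass (of_rat a2) (of_rat a4) (of_rat a6)) \<phi> \<and>
          filterlim \<phi> at_infinity (at (0, of_int (leg_V m n)) within quartic_H m n) \<and>
          generically (quartic_H m n) (\<lambda>(t, s). fst (\<phi> (t, s)) = X_fun m n t s))"


text \<open>Such a model exists, namely \<open>Y\<^sup>2 = (X + B)(X\<^sup>2 - 4\<gamma>\<^sup>4)\<close>, so \<open>weierstrass_model\<close> is not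
  vacuous.\<close>

lemma eval2_0: "eval2 0 p = 0" by (simp add: eval2_def)
lemma eval2_pCons: "eval2 (pCons c F) p = poly (map_poly of_rat c) (fst p) + snd p * eval2 F p"
  by (cases "c = 0 \<and> F = 0") (auto simp: eval2_def map_poly_pCons)

lemma map_poly_of_rat_pCons: "map_poly (of_rat::rat\<Rightarrow>complex) (pCons c F) = pCons (of_rat c) (map_poly of_rat F)"
  by (cases "c = 0 \<and> F = 0") (auto simp: map_poly_pCons)

lemma weierstrass_model_exists:
  assumes "m > n" "n > 0" "coprime m n" "odd (m-n)"
  shows "weierstrass_model m n (of_int (coeff_B m n)) (- 4 * of_int (leg_V m n)^4) (- 4 * of_int (leg_V m n)^4 * of_int (coeff_B m n))"
proof -
  define g where "g = leg_V m n"
  define b where "b = coeff_B m n"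
  have g0: "g > 0" using assms by (simp add: g_def leg_V_def)
  define gg where "gg = (of_int g :: complex)"
  define bb where "bb = (of_int b :: complex)"
  let ?gr = "of_int g :: rat" and ?br = "of_int b :: rat"
  have gn: "gg \<noteq> 0" using g0 by (simp add: gg_def)
  let ?H = "quartic_H m n :: (complex\<times>complex) set"
  define EE where "EE = weierstrass bb (- 4 * gg^4) (- 4 * gg^4 * bb)"
  have Hm: "(t,s) \<in> ?H \<longleftrightarrow> s^2 = gg^2 * t^4 + bb * t^2 + gg^2" for t s
    by (simp add: quartic_H_def g_def b_def gg_def bb_def)
  have Em: "(x,y) \<in> EE \<longleftrightarrow> y^2 = (x + bb) * (x^2 - 4 * gg^4)" for x y
    by (simp add: EE_def weierstrass_def algebra_simps power2_eq_square power3_eq_cube)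
  define phi where "phi = (\<lambda>(t,s). (2*gg*(s+gg)/t^2, (4*gg^2*(s+gg) + 2*gg*bb*t^2)/t^3))"
  define psi where "psi = (\<lambda>(x,y). (2*gg*(x+bb)/y, 2*gg*x*(x+bb)^2/y^2 - gg))"
  have finH: "finite {p\<in>?H. fst p = 0}"
    by (rule finite_subset[of _ "{(0,gg),(0,-gg)}"]) (auto simp: Hm power2_eq_iff)
  have rt: "finite {x. (x + bb) * (x^2 - 4 * gg^4) = 0}"
  proof (rule finite_subset[of _ "{-bb, 2*gg^2, -(2*gg^2)}"], safe)
    fix x assume "(x + bb) * (x^2 - 4 * gg^4) = 0" and n: "x \<notin> {}" "x \<noteq> - bb" "x \<noteq> 2*gg^2"
    then have "x^2 = 4 * gg^4" by (auto simp: add_eq_0_iff2)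
    then have "(x - 2*gg^2)*(x + 2*gg^2) = 0" by algebra
    then show "x = - (2*gg^2)" using n by (simp add: eq_neg_iff_add_eq_0)
  qed
  have finE: "finite {p\<in>EE. snd p = 0}"
    by (rule finite_subset[of _ "{x. (x + bb) * (x^2 - 4 * gg^4) = 0} \<times> {0}"])
       (use rt in \<open>auto simp: Em\<close>)
  have gH: "generically ?H Q" if "\<And>t s. (t,s) \<in> ?H \<Longrightarrow> t \<noteq> 0 \<Longrightarrow> Q (t,s)" for Q
    unfolding generically_def by (rule finite_subset[OF _ finH], safe, rule ccontr) (use that in force)
  have gE: "generically EE Q" if "\<And>t s. (t,s) \<in> EE \<Longrightarrow> s \<noteq> 0 \<Longrightarrow> Q (t,s)" for Q
    unfolding generically_def by (rule finite_subset[OF _ finE], safe, rule ccontr) (use that in force)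
  have phiE: "phi (t,s) \<in> EE" if h: "(t,s) \<in> ?H" "t \<noteq> 0" for t s
  proof -
    have s: "s^2 = gg^2 * t^4 + bb * t^2 + gg^2" using h Hm by simp
    have "(4*gg^2*(s+gg) + 2*gg*bb*t^2)^2 = (2*gg*(s+gg) + bb * t^2) * ((2*gg*(s+gg))^2 - 4*gg^4*t^4)"
      using s by algebra
    then show ?thesis using h unfolding phi_def by (simp add: Em field_simps)
  qed
  have pp: "psi (phi (t,s)) = (t,s)" if h: "(t,s) \<in> ?H" "t \<noteq> 0" "4*gg^2*(s+gg) + 2*gg*bb*t^2 \<noteq> 0" for t s
  proof -
    define D where "D = 4*gg^2*(s+gg) + 2*gg*bb*t^2"
    have D: "D \<noteq> 0" using h D_def by simp
    have e: "2*gg*(2*gg*(s+gg)/t^2 + bb) = D / t^2" using h unfolding D_def by (simp add: field_simps power2_eq_square)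
    have 1: "2*gg*(2*gg*(s+gg)/t^2 + bb) / (D/t^3) = t"
      unfolding e using D h by (simp add: field_simps power2_eq_square power3_eq_cube)
    have "2*gg*x*(x+bb)^2/y^2 - gg = x * (2*gg*(x+bb)/y)^2 / (2*gg) - gg" for x y
      using gn by (cases "y = 0") (simp_all add: field_simps power2_eq_square)
    then have 2: "psi (phi (t,s)) = (t, (2*gg*(s+gg)/t^2) * t^2 / (2*gg) - gg)"
      unfolding phi_def psi_def using 1 D_def by simp
    show ?thesis unfolding 2 using h gn by simp
  qed
  have Dn: "4*gg^2*(s+gg) + 2*gg*bb*t^2 \<noteq> 0" if h: "(t,s) \<in> ?H" and t: "t \<noteq> 0" for t s
  proof
    assume z: "4*gg^2*(s+gg) + 2*gg*bb*t^2 = 0"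
    have s: "s^2 = gg^2 * t^4 + bb * t^2 + gg^2" using h Hm by simp
    have "2*gg*(2*gg*(s+gg) + bb*t^2) = 0" using z by (simp add: algebra_simps power2_eq_square)
    then have z': "2*gg*(s+gg) + bb*t^2 = 0" using gn by simp
    then have "(2*gg * s)^2 = (2*gg^2 + bb*t^2)^2" by algebra
    then have "t^4 * (4*gg^4 - bb^2) = 0" using s by algebra
    then have "bb^2 = 4*gg^4" using t by simp
    then have "of_int (b^2) = (of_int (4*g^4) :: complex)" by (simp add: gg_def bb_def)
    then have "b^2 = 4*g^4" by (simp only: of_int_eq_iff)
    then have "b^2 = (2*g^2)^2" by (simp add: power_mult_distrib flip: power_mult)
    then have "b = 2*g^2 \<or> b = -(2*g^2)" by (simp only: power2_eq_iff)
    moreover have "b = 4 * (leg_U m n)^2 - 2*g^2" by (simp add: b_def coeff_B_def g_def)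
    ultimately have "(leg_U m n)^2 = g^2 \<or> leg_U m n = 0" by auto
    moreover have "leg_U m n > 0" using assms by (simp add: leg_U_def power_strict_mono)
    moreover have "odd (leg_U m n)" "even g" using assms by (auto simp: leg_U_def g_def leg_V_def)
    ultimately show False by (auto simp: power2_eq_iff)
  qed
  have psiH: "psi (x,y) \<in> ?H" if h: "(x,y) \<in> EE" "y \<noteq> 0" for x y
  proof -
    have e: "y^2 = (x + bb) * (x^2 - 4 * gg^4)" using h Em by simp
    have "(2*gg*x*(x+bb)^2 - gg*y^2)^2 = gg^2*(2*gg*(x+bb))^4 + bb*(2*gg*(x+bb))^2*y^2 + gg^2*y^4"
      using e by algebra
    note a = this
    have "2*gg*x*(x+bb)^2/y^2 - gg = (2*gg*x*(x+bb)^2 - gg*y^2)/y^2" using h(2) by (simp add: field_simps)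
    then have "(2*gg*x*(x+bb)^2/y^2 - gg)^2 = (2*gg*x*(x+bb)^2 - gg*y^2)^2/y^4"
      by (simp add: power_divide)
    also have "\<dots> = gg^2*(2*gg*(x+bb)/y)^4 + bb*(2*gg*(x+bb)/y)^2 + gg^2"
      unfolding a power_divide add_divide_distrib using h(2) by (simp add: field_simps power2_eq_square power4_eq_xxxx)
    finally have "(2*gg*x*(x+bb)^2/y^2 - gg)^2 = gg^2*(2*gg*(x+bb)/y)^4 + bb*(2*gg*(x+bb)/y)^2 + gg^2" .
    then show ?thesis unfolding psi_def by (simp add: Hm)
  qed
  have pp': "phi (psi (x,y)) = (x,y)" if h: "(x,y) \<in> EE" "y \<noteq> 0" for x y
  proof -
    have e: "y^2 = (x + bb) * (x^2 - 4 * gg^4)" using h Em by simp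
    have xb: "x + bb \<noteq> 0" using e h by auto
    define t where "t = 2*gg*(x+bb)/y"
    have t0: "t \<noteq> 0" using xb gn h by (simp add: t_def)
    have s: "2*gg*x*(x+bb)^2/y^2 - gg = x*t^2/(2*gg) - gg"
      unfolding t_def using gn h by (simp add: field_simps power2_eq_square)
    have "phi (psi (x,y)) = (x, (2*gg*(x*t^2) + 2*gg*bb*t^2)/t^3)"
      unfolding psi_def phi_def prod.case s t_def[symmetric] using t0 gn by (simp add: field_simps power2_eq_square)
    also have "(2*gg*(x*t^2) + 2*gg*bb*t^2)/t^3 = 2*gg*(x+bb)/t" 
      using t0 by (simp add: field_simps power2_eq_square power3_eq_cube)
    also have "\<dots> = y" unfolding t_def using xb gn h by simp
    finally show ?thesis .
  qed
  have "rational_function_on ?H (\<lambda>p. fst (phi p))"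
    unfolding rational_function_on_def
    by (rule exI[of _ "[:[:2*?gr^2:],[:2*?gr:]:]"], rule exI[of _ "[:[:0,0,1:]:]"], rule gH)
       (auto simp: eval2_0 eval2_pCons map_poly_of_rat_pCons phi_def gg_def bb_def of_rat_mult of_rat_power field_simps power2_eq_square)
  moreover have "rational_function_on ?H (\<lambda>p. snd (phi p))"
    unfolding rational_function_on_def
    by (rule exI[of _ "[:[:4*?gr^3,0,2*?gr*?br:],[:4*?gr^2:]:]"], rule exI[of _ "[:[:0,0,0,1:]:]"], rule gH)
       (auto simp: eval2_0 eval2_pCons map_poly_of_rat_pCons phi_def gg_def bb_def of_rat_mult of_rat_power field_simps power2_eq_square power3_eq_cube)
  moreover have "rational_function_on EE (\<lambda>p. fst (psi p))"
    unfolding rational_function_on_def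
    by (rule exI[of _ "[:[:2*?gr*?br,2*?gr:]:]"], rule exI[of _ "[:0,[:1:]:]"], rule gE)
       (auto simp: eval2_0 eval2_pCons map_poly_of_rat_pCons psi_def gg_def bb_def of_rat_mult of_rat_power field_simps power2_eq_square power3_eq_cube)
  moreover have "rational_function_on EE (\<lambda>p. snd (psi p))"
    unfolding rational_function_on_def
    by (rule exI[of _ "[:[:0,2*?gr*?br^2,4*?gr*?br,2*?gr:],0,[:-?gr:]:]"], rule exI[of _ "[:0,0,[:1:]:]"], rule gE)
       (auto simp: eval2_0 eval2_pCons map_poly_of_rat_pCons psi_def gg_def bb_def of_rat_mult of_rat_power of_rat_minus field_simps power2_eq_square power3_eq_cube)
  moreover have "generically ?H (\<lambda>p. phi p \<in> EE)" by (rule gH) (rule phiE)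
  moreover have "generically EE (\<lambda>p. psi p \<in> ?H)" by (rule gE) (rule psiH)
  moreover have "generically EE (\<lambda>p. phi (psi p) = p)" by (rule gE) (rule pp')
  moreover have "generically ?H (\<lambda>p. psi (phi p) = p)"
    by (rule gH) (use pp Dn in blast)
  ultimately have bir: "birational_map_on ?H EE phi"
    unfolding birational_map_on_def rational_map_on_def by blast
  have X: "generically ?H (\<lambda>(t,s). fst (phi (t,s)) = X_fun m n t s)"
    by (simp add: generically_def phi_def X_fun_def g_def gg_def)
  have lim: "filterlim phi at_infinity (at (0,gg) within ?H)"
  proof -
    let ?F = "at (0,gg) within ?H"
    have "eventually (\<lambda>p. fst p \<noteq> 0) ?F"
    proof -
      have "eventually (\<lambda>p::complex\<times>complex. snd p \<in> - {-gg}) ?F"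
        by (rule topological_tendstoD[of snd "gg"])
           (use gn in \<open>auto intro!: tendsto_eq_intros simp: eq_neg_iff_add_eq_0\<close>)
      moreover have "eventually (\<lambda>p. p \<in> ?H \<and> p \<noteq> (0,gg)) ?F"
        by (auto simp: eventually_at_filter)
      ultimately show ?thesis
      proof eventually_elim
        case (elim p) then show ?case by (cases p) (auto simp: Hm power2_eq_iff)
      qed
    qed
    then have "filterlim (\<lambda>p::complex\<times>complex. fst p ^ 2) (at 0) ?F"
      unfolding filterlim_at by (auto intro!: tendsto_eq_intros elim: eventually_mono)
    moreover have "((\<lambda>p::complex\<times>complex. 2*gg*(snd p+gg)) \<longlongrightarrow> 2*gg*(gg+gg)) ?F"
      by (auto intro!: tendsto_eq_intros)
    ultimately have "filterlim (\<lambda>p::complex\<times>complex. 2*gg*(snd p+gg) / fst p^2) at_infinity ?F"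
      unfolding divide_inverse using gn
      by (intro tendsto_mult_filterlim_at_infinity[where c="2*gg*(gg+gg)"] filterlim_compose[OF filterlim_inverse_at_infinity]) auto
    then have "filterlim (\<lambda>p. fst (phi p)) at_infinity ?F"
      by (simp add: phi_def case_prod_beta)
    then have "filterlim (\<lambda>p. norm (fst (phi p))) at_top ?F" by (rule filterlim_at_infinity_imp_norm_at_top)
    then have "filterlim (\<lambda>p. norm (phi p)) at_top ?F"
      by (rule filterlim_at_top_mono) (rule always_eventually, rule allI, metis norm_fst_le prod.collapse)
    then show ?thesis by (rule filterlim_norm_at_top_imp_at_infinity)
  qed
  show ?thesis unfolding weierstrass_model_def
    using bir X lim by (intro exI[of _ phi]) (simp add: of_rat_mult of_rat_power of_rat_minus g_def b_def EE_def gg_def bb_def)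
qed


subsection \<open>Rational points\<close>

datatype point = Infinity | Affine (X_coord: rat) (Y_coord: rat)

definition rational_points :: "rat \<Rightarrow> rat \<Rightarrow> rat \<Rightarrow> point set" where
  "rational_points a2 a4 a6 = insert Infinity {Affine x y | x y. (x, y) \<in> weierstrass a2 a4 a6}"

text \<open>The inverse in the group law of \<open>Y\<^sup>2 = X\<^sup>3 + a2 X\<^sup>2 + a4 X + a6\<close>; thus \<open>2P = O\<close> iff
  \<open>point_neg P = P\<close>.\<close>

fun point_neg :: "point \<Rightarrow> point" where
  "point_neg Infinity = Infinity"
| "point_neg (Affine x y) = Affine x (- y)"

definition two_torsion :: "rat \<Rightarrow> rat \<Rightarrow> rat \<Rightarrow> point set" where
  "two_torsion a2 a4 a6 = {P \<in> rational_points a2 a4 a6. point_neg P = P}"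

definition T_tau :: "int \<Rightarrow> int \<Rightarrow> rat \<Rightarrow> rat \<Rightarrow> rat \<Rightarrow> point set" where
  "T_tau m n a2 a4 a6 =
     {P \<in> two_torsion a2 a4 a6. P \<noteq> Infinity \<and>
        (X_coord P = 2 * (of_int (leg_V m n))\<^sup>2 \<or> X_coord P = - 2 * (of_int (leg_V m n))\<^sup>2)}"

definition tau :: "int \<Rightarrow> int \<Rightarrow> rat \<Rightarrow> rat" where
  "tau m n x = 4 * (of_int (leg_V m n))\<^sup>2 * (x + of_int (coeff_B m n)) / (x\<^sup>2 - 4 * (of_int (leg_V m n)) ^ 4)"

text \<open>Only used for \<open>P \<noteq> Infinity\<close>.\<close>

definition lifts_to :: "int \<Rightarrow> int \<Rightarrow> point \<Rightarrow> rat \<Rightarrow> bool" where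
  "lifts_to m n P t \<longleftrightarrow> t \<noteq> 0 \<and> (\<exists>s. (t, s) \<in> quartic_H m n \<and> X_fun m n t s = X_coord P)"

end

theory Submission
  imports Defs
begin

text \<open>Write \<open>\<gamma> = V\<^sub>2\<close>. For a fixed value \<open>x\<close> of the \<open>X\<close>-coordinate and a fixed \<open>t \<noteq> 0\<close>, the
  relation \<open>X(t, s) = x\<close> is linear in \<open>s\<close>, with the single solution \<open>s = x t\<^sup>2 / (2 \<gamma>) - \<gamma>\<close>.
  Substituted into the quartic, its constant terms \<open>\<gamma>\<^sup>2\<close> cancel, and division by \<open>t\<^sup>2\<close> and
  multiplication by \<open>4 \<gamma>\<^sup>2\<close> leave
  \<open>t\<^sup>2 (x\<^sup>2 - 4 \<gamma>\<^sup>4) = 4 \<gamma>\<^sup>2 (x + B)\<close> (\<open>lifts_to_iff_equation\<close>), which says \<open>t\<^sup>2 = \<tau>(x)\<close>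
  as soon as \<open>x\<^sup>2 \<noteq> 4 \<gamma>\<^sup>4\<close>. If \<open>x = \<plusminus>2 \<gamma>\<^sup>2\<close>, the left side vanishes while the right side does not,
  because \<open>B = \<plusminus>2 \<gamma>\<^sup>2\<close> would mean \<open>U\<^sub>2 = 0\<close> or \<open>U\<^sub>2 = \<plusminus>V\<^sub>2\<close>, impossible since \<open>U\<^sub>2\<close> is odd
  and \<open>V\<^sub>2\<close> is even. So the lifts are exactly the nonzero square roots of \<open>\<tau>(x)\<close>
  (\<open>lifts_to_iff_tau\<close>), from which the criterion and the uniqueness up to sign follow.

  For the last part, \<open>M(a, b, m, n)\<close> is the right-hand side of the quartic at \<open>t = a / b\<close>,
  homogenised by \<open>b\<^sup>4\<close> (\<open>master_M_eq_homogenised_quartic\<close>). A lift thus makes it the square of a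
  rational number, hence, \<open>\<int>\<close> being integrally closed, of an integer. Of the conditions for a
  Master-Hit only the order and the parity of \<open>a'\<close> and \<open>b'\<close> remain.\<close>

lemma odd_leg_U:
  assumes "odd (m - n)"
  shows "odd (leg_U m n)"
  using assms by (auto simp: leg_U_def)

lemma leg_V_pos:
  assumes "m > n" "n > 0"
  shows "leg_V m n > 0"
  using assms by (simp add: leg_V_def)

text \<open>Equivalently, \<open>X + B\<close> and \<open>X\<^sup>2 - 4 \<gamma>\<^sup>4\<close> have no common root, so that, for \<open>\<gamma> \<noteq> 0\<close>,
  \<open>\<tau>\<close> has genuine poles at \<open>X = \<plusminus>2 \<gamma>\<^sup>2\<close>. The reason is \<open>B\<^sup>2 - 4 \<gamma>\<^sup>4 = 16 U\<^sub>2\<^sup>2 (U\<^sub>2 - \<gamma>) (U\<^sub>2 + \<gamma>)\<close>, where each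
  factor \<open>U\<^sub>2\<close>, \<open>U\<^sub>2 \<plusminus> \<gamma>\<close> is odd.\<close>

lemma coeff_B_square_neq:
  assumes "odd (m - n)"
  shows "(coeff_B m n)\<^sup>2 \<noteq> 4 * leg_V m n ^ 4"
proof
  define U where "U = leg_U m n"
  define g where "g = leg_V m n"
  assume "(coeff_B m n)\<^sup>2 = 4 * leg_V m n ^ 4"
  then have "(4 * U\<^sup>2 - 2 * g\<^sup>2)\<^sup>2 = 4 * g ^ 4"
    by (simp add: coeff_B_def U_def g_def)
  then have "16 * (U\<^sup>2 * ((U - g) * (U + g))) = 0"
    by algebra
  then have "U = 0 \<or> U = g \<or> U = - g"
    by auto
  moreover have "odd U" "even g"
    using odd_leg_U[OF assms] by (simp_all add: U_def g_def leg_V_def)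
  ultimately show False
    by auto
qed

lemma X_fun_eq_iff:
  fixes t s x :: "'a::field_char_0"
  assumes "t \<noteq> 0" "leg_V m n \<noteq> 0"
  shows "X_fun m n t s = x \<longleftrightarrow>
           s = x * t\<^sup>2 / (2 * of_int (leg_V m n)) - of_int (leg_V m n)"
  using assms by (auto simp: X_fun_def field_simps)

lemma lifts_to_iff_equation:
  assumes "leg_V m n \<noteq> 0"
  shows "lifts_to m n P t \<longleftrightarrow> t \<noteq> 0 \<and>
           t\<^sup>2 * ((X_coord P)\<^sup>2 - 4 * of_int (leg_V m n) ^ 4) =
           4 * (of_int (leg_V m n))\<^sup>2 * (X_coord P + of_int (coeff_B m n))"
proof (cases "t = 0")
  case False
  define g :: rat where "g = of_int (leg_V m n)"
  define B :: rat where "B = of_int (coeff_B m n)"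
  define x where "x = X_coord P"
  define s where "s = x * t\<^sup>2 / (2 * g) - g"
  have g: "g \<noteq> 0"
    using assms by (simp add: g_def)
  have "lifts_to m n P t \<longleftrightarrow> s\<^sup>2 = g\<^sup>2 * t ^ 4 + B * t\<^sup>2 + g\<^sup>2"
    using False
    by (simp add: lifts_to_def X_fun_eq_iff[OF False assms] quartic_H_def s_def g_def B_def x_def)
  also have "\<dots> \<longleftrightarrow> 4 * g\<^sup>2 * (s\<^sup>2 - (g\<^sup>2 * t ^ 4 + B * t\<^sup>2 + g\<^sup>2)) = 0"
    using g by simp
  also have "4 * g\<^sup>2 * (s\<^sup>2 - (g\<^sup>2 * t ^ 4 + B * t\<^sup>2 + g\<^sup>2)) =
             t\<^sup>2 * (t\<^sup>2 * (x\<^sup>2 - 4 * g ^ 4) - 4 * g\<^sup>2 * (x + B))"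
  proof -
    have "2 * g * s = x * t\<^sup>2 - 2 * g\<^sup>2"
      using g by (simp add: s_def field_simps power2_eq_square)
    then show ?thesis
      by algebra
  qed
  finally show ?thesis
    using False by (simp add: g_def B_def x_def)
qed (simp add: lifts_to_def)

text \<open>The equivalence also holds at \<open>X = \<plusminus>2 \<gamma>\<^sup>2\<close>: there is no lift there, and \<open>tau\<close> takes
  the value \<open>0\<close> by the convention for division by zero, which is not the square of any \<open>t \<noteq> 0\<close>.\<close>

lemma lifts_to_iff_tau:
  assumes "m > n" "n > 0" "odd (m - n)"
  shows "lifts_to m n P t \<longleftrightarrow> t \<noteq> 0 \<and> tau m n (X_coord P) = t\<^sup>2"
proof -
  define g :: rat where "g = of_int (leg_V m n)"
  define B :: rat where "B = of_int (coeff_B m n)"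
  define x where "x = X_coord P"
  have g: "leg_V m n \<noteq> 0" "g \<noteq> 0"
    using leg_V_pos[OF assms(1,2)] by (simp_all add: g_def)
  have lift: "lifts_to m n P t \<longleftrightarrow> t \<noteq> 0 \<and> t\<^sup>2 * (x\<^sup>2 - 4 * g ^ 4) = 4 * g\<^sup>2 * (x + B)"
    unfolding g_def B_def x_def by (rule lifts_to_iff_equation[OF g(1)])
  have tau: "tau m n x = 4 * g\<^sup>2 * (x + B) / (x\<^sup>2 - 4 * g ^ 4)"
    by (simp add: tau_def g_def B_def)
  show ?thesis
  proof (cases "x\<^sup>2 = 4 * g ^ 4")
    case True
    have "of_int ((coeff_B m n)\<^sup>2) \<noteq> (of_int (4 * leg_V m n ^ 4) :: rat)"
      unfolding of_int_eq_iff by (rule coeff_B_square_neq[OF assms(3)])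
    then have "B\<^sup>2 \<noteq> x\<^sup>2"
      by (simp add: True B_def g_def)
    then have "x + B \<noteq> 0"
      by (auto simp: add_eq_0_iff)
    then show ?thesis
      using lift tau True g by (auto simp: x_def)
  next
    case False
    then have "tau m n x = t\<^sup>2 \<longleftrightarrow> 4 * g\<^sup>2 * (x + B) = t\<^sup>2 * (x\<^sup>2 - 4 * g ^ 4)"
      unfolding tau by (subst divide_eq_eq) simp
    then show ?thesis
      unfolding lift by (auto simp: x_def)
  qed
qed

lemma master_M_eq_homogenised_quartic:
  "master_M a b m n =
     (leg_V m n)\<^sup>2 * a ^ 4 + coeff_B m n * a\<^sup>2 * b\<^sup>2 + (leg_V m n)\<^sup>2 * b ^ 4"
proof -
  have "master_M a b m n = (2 * a * b * leg_U m n)\<^sup>2 + ((a\<^sup>2 - b\<^sup>2) * leg_V m n)\<^sup>2"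
    by (simp add: master_M_def leg_U_def[of a b] leg_V_def[of a b])
  also have "\<dots> = (leg_V m n)\<^sup>2 * a ^ 4
      + (4 * (leg_U m n)\<^sup>2 - 2 * (leg_V m n)\<^sup>2) * a\<^sup>2 * b\<^sup>2 + (leg_V m n)\<^sup>2 * b ^ 4"
    by algebra
  finally show ?thesis
    by (simp add: coeff_B_def)
qed

lemma int_square_if_rat_square:
  fixes k :: int and r :: rat
  assumes "of_int k = r\<^sup>2"
  shows "\<exists>j. k = j\<^sup>2"
proof -
  have "r = of_rat r"
    by simp
  then have rational: "r \<in> \<rat>"
    by (metis Rats_of_rat)
  have "algebraic_int (r\<^sup>2)"
    by (simp flip: assms)
  then have "algebraic_int r"
    by (rule algebraic_int_root[of _ "monom 1 2"])
       (auto simp: poly_monom coeff_monom degree_monom_eq)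
  then have "r \<in> \<int>"
    using rational by (rule rational_algebraic_int_is_int)
  then obtain j where "r = of_int j"
    by (elim Ints_cases)
  then have "of_int k = (of_int (j\<^sup>2) :: rat)"
    using assms by simp
  then show ?thesis
    unfolding of_int_eq_iff by blast
qed

lemma master_M_square_if_quartic_point:
  fixes s :: rat
  assumes "(of_int a / of_int b, s) \<in> quartic_H m n" "b \<noteq> 0"
  shows "\<exists>k. master_M a b m n = k\<^sup>2"
proof (rule int_square_if_rat_square)
  define t :: rat where "t = of_int a / of_int b"
  have a: "of_int a = t * of_int b"
    using assms(2) by (simp add: t_def)
  have "s\<^sup>2 = (of_int (leg_V m n))\<^sup>2 * t ^ 4 + of_int (coeff_B m n) * t\<^sup>2 + (of_int (leg_V m n))\<^sup>2"
    using assms(1) by (simp add: quartic_H_def t_def)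
  then have "(s * (of_int b)\<^sup>2)\<^sup>2 =
      (of_int (leg_V m n))\<^sup>2 * (t * of_int b) ^ 4
      + of_int (coeff_B m n) * (t * of_int b)\<^sup>2 * (of_int b)\<^sup>2
      + (of_int (leg_V m n))\<^sup>2 * of_int b ^ 4"
    by algebra
  then show "of_int (master_M a b m n) = (s * (of_int b)\<^sup>2)\<^sup>2"
    by (simp add: master_M_eq_homogenised_quartic a)
qed

theorem lemma3p1:
  fixes m n :: int and a2 a4 a6 :: rat and P :: point
  assumes "m > n" and "n > 0" and "coprime m n" and "odd (m - n)"
    and "weierstrass_model m n a2 a4 a6"
    and "P \<in> rational_points a2 a4 a6 - ({Infinity} \<union> T_tau m n a2 a4 a6)"
  shows "((\<exists>t. lifts_to m n P t) \<longleftrightarrow>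
            tau m n (X_coord P) > 0 \<and> (\<exists>r. tau m n (X_coord P) = r\<^sup>2)) \<and>
         (\<forall>t t'. lifts_to m n P t \<longrightarrow> (lifts_to m n P t' \<longleftrightarrow> t' = t \<or> t' = - t)) \<and>
         (\<forall>t. \<forall>a b a' b' :: int.
            lifts_to m n P t \<and> t = of_int a / of_int b \<and> b > 0 \<and> coprime a b \<and>
            \<bar>of_int a / of_int b :: rat\<bar> = of_int a' / of_int b' \<and> a' > 0 \<and> b' > 0 \<and> coprime a' b' \<longrightarrow>
            (master_hit a' b' m n \<longleftrightarrow> a' > b' \<and> odd (a' - b')))"
proof (intro conjI allI impI)
  note lift = lifts_to_iff_tau[OF assms(1,2,4)]
  show "(\<exists>t. lifts_to m n P t) \<longleftrightarrow>
          tau m n (X_coord P) > 0 \<and> (\<exists>r. tau m n (X_coord P) = r\<^sup>2)"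
    unfolding lift by (auto simp: zero_less_power2)
  show sign: "lifts_to m n P t' \<longleftrightarrow> t' = t \<or> t' = - t" if "lifts_to m n P t" for t t'
    using that unfolding lift by (auto simp: power2_eq_iff)
  fix t and a b a' b' :: int
  assume h: "lifts_to m n P t \<and> t = of_int a / of_int b \<and> b > 0 \<and> coprime a b \<and>
    \<bar>of_int a / of_int b :: rat\<bar> = of_int a' / of_int b' \<and> a' > 0 \<and> b' > 0 \<and> coprime a' b'"
  have "\<bar>t\<bar> = t \<or> \<bar>t\<bar> = - t"
    by (simp add: abs_if)
  then have "lifts_to m n P \<bar>t\<bar>"
    using h sign by blast
  then have "lifts_to m n P (of_int a' / of_int b')"
    using h by metis
  then obtain s :: rat where "(of_int a' / of_int b', s) \<in> quartic_H m n"
    by (auto simp: lifts_to_def)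
  then have "\<exists>k. master_M a' b' m n = k\<^sup>2"
    using h by (intro master_M_square_if_quartic_point) auto
  then show "master_hit a' b' m n \<longleftrightarrow> a' > b' \<and> odd (a' - b')"
    using h assms(1-4) by (auto simp: master_hit_def)
qed

end
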